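(* Let $m\in\mathbb N$ and, for $(x,y)\in[0,1]^2$, consider the deep ReLU network with $m+3$ hidden layers $$P_m(x,y)=\mathbf w_{m+3}\boldsymbol\sigma_{\mathbf v_{m+3}}\bigl(\mathbf w_{m+2}\boldsymbol\sigma_{\mathbf v_{m+2}}(\cdots\mathbf w_1\boldsymbol\sigma_{\mathbf v_1}(\boldsymbol\ell^m_{x,y})\cdots)\bigr),$$ where $$\boldsymbol\ell^m_{x,y}=\tfrac12\Bigl(\tfrac{x-y+1}{2},\ x-y+1,\ x+y+2^{-m},\ \tfrac{x+y}{2},\ x+y,\ \tfrac12\Bigr)^\top,$$ $\mathbf v_k=\mathbf 1_2\otimes(0,2^{1-2k},0)^\top$ for $1\le k\le m+1$, $\mathbf v_{m+2}=\mathbf v_{m+3}=-1$, $\mathbf w_k=\mathbf I_2\otimes\widetilde{\mathbf w}$ for $1\le k\le m$, $\mathbf w_{m+1}=(-1,1,-1,1,-1,1)$, $\mathbf w_{m+2}=-1$, $\mathbf w_{m+3}=1$, and $$\widetilde{\mathbf w}=\begin{pmatrix}\frac12&-\frac12&0\\1&-1&0\\1&-1&1\end{pmatrix}.$$ The function $P_m$ is piecewise linear in $x$ and $y$, and $\frac{\partial}{\partial x}P_m$ is defined accordingly (piece by piece). Let $\mathbb C_m=[0,1-2^{-m}]\times[0,1]$. Then: 1. $0\le P_m(x,y)\le1$ on $[0,1]^2$, and $P_m(1,1)=1$; 2. $0\le P_m(x,y)-xy\le2^{-m}$ on $\mathbb C_m$; 3. $\sup_{(x,y)\in\mathbb C_m}\bigl|\frac{\partial}{\partial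 x}P_m(x,y)-y\bigr|\le2^{-m-1}$.
   Context: $\sigma(x)=\max(x,0)$ is the ReLU function, and for $\mathbf u,\mathbf v\in\mathbb R^n$, $\boldsymbol\sigma_{\mathbf v}(\mathbf u)=(\sigma(u_1-v_1),\dots,\sigma(u_n-v_n))^\top$. $\otimes$ is the Kronecker product, $\mathbf I_n$ the identity matrix, $\mathbf 1_n$ the $n$-vector of ones. The derivative of a piecewise linear function is understood as the slope of its linear pieces (at a breakpoint, the slope of the piece to which the point is assigned). *)

theory Defs
  imports "HOL-Analysis.Polytope" "Jordan_Normal_Form.Matrix"
begin

unbundle no vec_syntax

definition kron_mat :: "real mat \<Rightarrow> real mat \<Rightarrow> real mat" where
  "kron_mat A B = Matrix.mat (dim_row A * dim_row B) (dim_col A * dim_col B)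
     (\<lambda>(i, j). A $$ (i div dim_row B, j div dim_col B) * B $$ (i mod dim_row B, j mod dim_col B))"

definition kron_vec :: "real Matrix.vec \<Rightarrow> real Matrix.vec \<Rightarrow> real Matrix.vec" where
  "kron_vec a b = Matrix.vec (dim_vec a * dim_vec b)
     (\<lambda>i. a $ (i div dim_vec b) * b $ (i mod dim_vec b))"

definition ones_vec :: "nat \<Rightarrow> real Matrix.vec" where
  "ones_vec n = Matrix.vec n (\<lambda>_. 1)"

definition relu :: "real \<Rightarrow> real" where
  "relu x = max x 0"

definition shifted_relu :: "real Matrix.vec \<Rightarrow> real Matrix.vec \<Rightarrow> real Matrix.vec" where
  "shifted_relu v u = Matrix.vec (dim_vec u) (\<lambda>i. relu (u $ i - v $ i))"

(* Weights w and shifts v are indexed by the layer, starting from 1;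
   w 0 and v 0 are irrelevant. *)
primrec relu_network ::
  "(nat \<Rightarrow> real mat) \<Rightarrow> (nat \<Rightarrow> real Matrix.vec) \<Rightarrow> real Matrix.vec \<Rightarrow> nat \<Rightarrow> real Matrix.vec" where
  "relu_network w v l 0 = l"
| "relu_network w v l (Suc k) = w (Suc k) *\<^sub>v shifted_relu (v (Suc k)) (relu_network w v l k)"

definition P_input :: "nat \<Rightarrow> real \<Rightarrow> real \<Rightarrow> real Matrix.vec" where
  "P_input m x y = (1/2) \<cdot>\<^sub>v vec_of_list
     [(x - y + 1) / 2, x - y + 1, x + y + 2 powi (- int m), (x + y) / 2, x + y, 1/2]"

definition w_tilde :: "real mat" where
  "w_tilde = mat_of_rows_list 3
     [[1/2, -1/2, 0],
      [1,   -1,   0],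
      [1,   -1,   1]]"

definition P_weight :: "nat \<Rightarrow> nat \<Rightarrow> real mat" where
  "P_weight m k =
     (if k \<le> m then kron_mat (1\<^sub>m 2) w_tilde
      else if k = m + 1 then mat_of_rows_list 6 [[-1, 1, -1, 1, -1, 1]]
      else if k = m + 2 then mat_of_rows_list 1 [[-1]]
      else mat_of_rows_list 1 [[1]])"

definition P_shift :: "nat \<Rightarrow> nat \<Rightarrow> real Matrix.vec" where
  "P_shift m k =
     (if k \<le> m + 1 then kron_vec (ones_vec 2) (vec_of_list [0, 2 powi (1 - 2 * int k), 0])
      else vec_of_list [-1])"

(* The output layer has width one. *)
definition P_net :: "nat \<Rightarrow> real \<Rightarrow> real \<Rightarrow> real" where
  "P_net m x y = relu_network (P_weight m) (P_shift m) (P_input m x y) (m + 3) $ 0"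

definition unit_square :: "(real \<times> real) set" where
  "unit_square = {0..1} \<times> {0..1}"

definition C_region :: "nat \<Rightarrow> (real \<times> real) set" where
  "C_region m = {0..1 - 2 powi (- int m)} \<times> {0..1}"

(* The slope in x of an affine piece; it is unique when S has nonempty interior. *)
definition has_x_slope_on :: "(real \<Rightarrow> real \<Rightarrow> real) \<Rightarrow> real \<Rightarrow> (real \<times> real) set \<Rightarrow> bool" where
  "has_x_slope_on f a S \<longleftrightarrow> (\<exists>b c. \<forall>(x, y)\<in>S. f x y = a * x + b * y + c)"

definition linear_pieces ::
  "(real \<Rightarrow> real \<Rightarrow> real) \<Rightarrow> (real \<times> real) set \<Rightarrow> (real \<times> real) set set \<Rightarrow> bool" where
  "linear_pieces f Q \<S> \<longleftrightarrow> finite \<S> \<and> \<Union>\<S> = Q \<and>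
     (\<forall>S\<in>\<S>. polytope S \<and> interior S \<noteq> {} \<and> (\<exists>a. has_x_slope_on f a S))"

definition piecewise_linear_on :: "(real \<times> real) set \<Rightarrow> (real \<Rightarrow> real \<Rightarrow> real) \<Rightarrow> bool" where
  "piecewise_linear_on Q f \<longleftrightarrow> (\<exists>\<S>. linear_pieces f Q \<S>)"

(* D is a version of the partial derivative of f in x on Q, taken piece by piece: the pieces
   are closed, so they overlap in the breakpoints, and each point p is assigned to one
   of the pieces containing it, in an arbitrary way. *)
definition piecewise_x_derivative ::
  "(real \<times> real) set \<Rightarrow> (real \<Rightarrow> real \<Rightarrow> real) \<Rightarrow> (real \<Rightarrow> real \<Rightarrow> real) \<Rightarrow> bool" where
  "piecewise_x_derivative Q f D \<longleftrightarrow> (\<exists>\<S> piece. linear_pieces f Q \<S> \<and>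
     (\<forall>(x, y)\<in>Q. piece (x, y) \<in> \<S> \<and> (x, y) \<in> piece (x, y) \<and>
        has_x_slope_on f (D x y) (piece (x, y))))"

end

theory Submission
  imports Defs
begin

text \<open>
  Put \<open>a = (x - y + 1) / 2\<close> and \<open>b = (x + y) / 2\<close>, so that \<open>x * y = b\<^sup>2 - a\<^sup>2 + a - 1/4\<close>. The first
  \<open>m + 1\<close> layers iterate the tent map on \<open>a\<close> and \<open>b\<close> and thereby replace the squares by their linear
  interpolants at the multiples of \<open>1/2^(m + 1)\<close>. The interpolation error lies between \<open>0\<close> and
  \<open>1/4^(m + 2)\<close> and is \<open>1/2^(m + 1)\<close>-Lipschitz; the latter bounds the error of the slopes.
  The last two layers truncate to \<open>[0, 1]\<close>, which has no effect in a neighbourhood of \<open>C_region m\<close>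
  in the unit square.
\<close>

section \<open>The tent map and the interpolation error of the square\<close>

definition tent :: "real \<Rightarrow> real" where
  "tent t = 1 - \<bar>2 * t - 1\<bar>"

lemma tent_bounds: "0 \<le> t \<Longrightarrow> t \<le> 1 \<Longrightarrow> 0 \<le> tent t \<and> tent t \<le> 1"
  by (auto simp: tent_def)

lemma funpow_tent_bounds:
  assumes "0 \<le> t" "t \<le> 1"
  shows "0 \<le> (tent ^^ n) t" "(tent ^^ n) t \<le> 1"
  using assms tent_bounds by (induction n) auto

text \<open>Both slopes of the tent map have modulus \<open>2\<close>, so each iteration doubles the
  Lipschitz constant.\<close>

lemma funpow_tent_lipschitz: "\<bar>(tent ^^ n) s - (tent ^^ n) t\<bar> \<le> 2 ^ n * \<bar>s - t\<bar>"
proof (induction n)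
  case (Suc n)
  have "\<bar>tent u - tent v\<bar> \<le> 2 * \<bar>u - v\<bar>" for u v
    by (auto simp: tent_def abs_if)
  from this[of "(tent ^^ n) s" "(tent ^^ n) t"] Suc show ?case by simp
qed simp

text \<open>The error of the linear interpolation of \<open>t\<^sup>2\<close> at the multiples of \<open>1/2^n\<close>.\<close>
definition square_error :: "nat \<Rightarrow> real \<Rightarrow> real" where
  "square_error n t = ((tent ^^ n) t - ((tent ^^ n) t)\<^sup>2) / 4 ^ n"

text \<open>On a mesh interval \<open>[p, p + h]\<close> with \<open>h = 1/2^n\<close>, the chord of
  the square exceeds it by \<open>(t - p) * (p + h - t) = h^2 * u * (1 - u)\<close>, where the tent
  iterate \<open>u\<close> is the relative position of \<open>t\<close> or its mirror image. The
  factor \<open>u * (1 - u)\<close> lies in \<open>[0, 1/4]\<close>.\<close>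

lemma square_error_bounds:
  assumes "0 \<le> t" "t \<le> 1"
  shows "0 \<le> square_error n t" "square_error n t \<le> 1 / 4 ^ Suc n"
proof -
  let ?u = "(tent ^^ n) t"
  have "0 \<le> ?u - ?u\<^sup>2"
    using funpow_tent_bounds[OF assms, of n] by (simp add: power2_eq_square mult_left_le)
  then show "0 \<le> square_error n t" by (simp add: square_error_def)
  have "?u - ?u\<^sup>2 \<le> 1 / 4"
    using zero_le_power2[of "?u - 1 / 2"] by (simp add: power2_eq_square algebra_simps)
  then show "square_error n t \<le> 1 / 4 ^ Suc n"
    by (simp add: square_error_def divide_simps)
qed

text \<open>The difference factors through \<open>(u - v) * (1 - u - v)\<close>, whose second factor
  has modulus at most \<open>1\<close>. The first grows like \<open>2 ^ n\<close>, and dividing by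
  \<open>4 ^ n\<close> leaves \<open>1 / 2 ^ n\<close>.\<close>

lemma square_error_lipschitz:
  assumes "0 \<le> s" "s \<le> 1" "0 \<le> t" "t \<le> 1"
  shows "\<bar>square_error n s - square_error n t\<bar> \<le> \<bar>s - t\<bar> / 2 ^ n"
proof -
  let ?u = "(tent ^^ n) s" and ?v = "(tent ^^ n) t"
  have "square_error n s - square_error n t = (?u - ?v) * (1 - ?u - ?v) / 4 ^ n"
    by (simp add: square_error_def divide_simps power2_eq_square) (simp add: algebra_simps)
  then have "\<bar>square_error n s - square_error n t\<bar> = \<bar>?u - ?v\<bar> * \<bar>1 - ?u - ?v\<bar> / 4 ^ n"
    by (simp add: abs_mult)
  also have "\<dots> \<le> (2 ^ n * \<bar>s - t\<bar>) * 1 / 4 ^ n"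
    using funpow_tent_bounds[OF assms(1,2), of n] funpow_tent_bounds[OF assms(3,4), of n]
    by (intro divide_right_mono mult_mono funpow_tent_lipschitz) auto
  also have "\<dots> = \<bar>s - t\<bar> / 2 ^ n"
    using power_mult_distrib[of "2::real" 2 n] by simp
  finally show ?thesis .
qed

text \<open>Halving the mesh removes a scaled sawtooth from the error, by
  \<open>4 * (u - u^2) = 2 * tent u - (tent u)^2\<close>. The sawtooths that the network adds up
  therefore telescope.\<close>

lemma square_error_Suc:
  "square_error n t = square_error (Suc n) t + (tent ^^ Suc n) t / 4 ^ Suc n"
proof -
  have "4 * (u - u\<^sup>2) = 2 * tent u - (tent u)\<^sup>2" for u
    by (auto simp: tent_def abs_if power2_eq_square algebra_simps)
  from this[of "(tent ^^ n) t"]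
  have eq: "(tent ^^ n) t - ((tent ^^ n) t)\<^sup>2 =
      ((tent ^^ Suc n) t - ((tent ^^ Suc n) t)\<^sup>2 + (tent ^^ Suc n) t) / 4"
    by simp
  show ?thesis
    unfolding square_error_def eq by (simp add: add_divide_distrib diff_divide_distrib)
qed

section \<open>Evaluation of the network, layer by layer\<close>

text \<open>Up to the factor \<open>1 / 4 ^ k\<close>, the two neurons form
  \<open>t/2 - max (t - 1/2) 0\<close>, a hat of height \<open>1/4\<close> with its peak at
  \<open>1/2\<close>.\<close>

lemma relu_tent:
  assumes "0 \<le> t" "t \<le> 1"
  shows "relu (t / (2 * 4 ^ k)) - relu (t / 4 ^ k - 1 / (2 * 4 ^ k)) = tent t / 4 ^ Suc k"
proof -
  have "t / 4 ^ k - 1 / (2 * 4 ^ k) = (2 * t - 1) / (2 * 4 ^ k)"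
    by (simp add: field_simps)
  then show ?thesis
    using assms
    by (auto simp: relu_def max_def tent_def abs_if field_simps)
qed

text \<open>With the Kronecker product written out as rows, simplification can evaluate a layer. The
  two diagonal blocks process \<open>a\<close> and \<open>b\<close> separately.\<close>

lemma P_weight_block:
  assumes "k \<le> m"
  shows "P_weight m k = mat_of_rows_list 6
    [[1/2, -1/2, 0, 0, 0, 0], [1, -1, 0, 0, 0, 0], [1, -1, 1, 0, 0, 0],
     [0, 0, 0, 1/2, -1/2, 0], [0, 0, 0, 1, -1, 0], [0, 0, 0, 1, -1, 1]]" (is "_ = ?A")
proof (rule eq_matI)
  fix i j assume "i < dim_row ?A" "j < dim_col ?A"
  then have "i = 0 \<or> i = 1 \<or> i = 2 \<or> i = 3 \<or> i = 4 \<or> i = 5"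
    "j = 0 \<or> j = 1 \<or> j = 2 \<or> j = 3 \<or> j = 4 \<or> j = 5"
    by (auto simp: mat_of_rows_list_def)
  then show "P_weight m k $$ (i, j) = ?A $$ (i, j)"
    using assms
    by (elim disjE)
      (simp_all add: P_weight_def kron_mat_def w_tilde_def mat_of_rows_list_def)
qed (use assms in \<open>simp_all add: P_weight_def kron_mat_def w_tilde_def mat_of_rows_list_def\<close>)

lemma P_shift_block:
  assumes "k \<le> m"
  shows "P_shift m (Suc k) = vec_of_list [0, 1 / (2 * 4 ^ k), 0, 0, 1 / (2 * 4 ^ k), 0]"
    (is "_ = ?v")
proof (rule eq_vecI)
  \<comment> \<open>Layers count from \<open>1\<close>, so layer \<open>Suc k\<close> gets exactly
    the shift \<open>1 / (2 * 4 ^ k)\<close> of \<open>relu_tent\<close>.\<close>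
  have "1 - 2 * int (Suc k) = - int (2 * k + 1)" by simp
  then have "(2::real) powi (1 - 2 * int (Suc k)) = 1 / 2 ^ (2 * k + 1)"
    by (simp only: power_int_minus power_int_of_nat) (simp add: divide_simps)
  then have eq: "(2::real) powi (1 - 2 * int (Suc k)) = 1 / (2 * 4 ^ k)"
    by (simp add: power_mult)
  fix i assume "i < dim_vec ?v"
  then have "i = 0 \<or> i = 1 \<or> i = 2 \<or> i = 3 \<or> i = 4 \<or> i = 5"
    by auto
  then show "P_shift m (Suc k) $ i = ?v $ i"
    using assms eq unfolding P_shift_def kron_vec_def ones_vec_def
    by (elim disjE) (simp_all add: vec_of_list_index del: of_nat_Suc vec_of_list_Cons)
qed (use assms in \<open>simp add: P_shift_def kron_vec_def ones_vec_def\<close>)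


lemma shifted_relu_vec_of_list:
  "length us = length vs \<Longrightarrow>
    shifted_relu (vec_of_list vs) (vec_of_list us) = vec_of_list (map2 (\<lambda>u v. relu (u - v)) us vs)"
  by (rule eq_vecI) (auto simp: shifted_relu_def vec_of_list_index)

lemma mult_mat_of_rows_list_vec_of_list:
  assumes "length us = n" "\<forall>r\<in>set rs. length r = n"
  shows "mat_of_rows_list n rs *\<^sub>v vec_of_list us = vec_of_list (map (\<lambda>r. \<Sum>(c, u)\<leftarrow>zip r us. c * u) rs)"
proof (rule eq_vecI)
  fix i assume "i < dim_vec (vec_of_list (map (\<lambda>r. \<Sum>(c, u)\<leftarrow>zip r us. c * u) rs))"
  then have i: "i < length rs" by simp
  then have len: "length (rs ! i) = n" using assms(2) by simp
  have "(\<Sum>j = 0..<n. mat_of_rows_list n rs $$ (i, j) * vec_of_list us $ j)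
      = (\<Sum>j = 0..<n. rs ! i ! j * us ! j)"
    using i by (intro sum.cong) (auto simp: mat_of_rows_list_def vec_of_list_index)
  also have "\<dots> = (\<Sum>(c, u)\<leftarrow>zip (rs ! i) us. c * u)"
    using len assms(1) by (simp add: sum_list_sum_nth)
  finally show "(mat_of_rows_list n rs *\<^sub>v vec_of_list us) $ i
      = vec_of_list (map (\<lambda>r. \<Sum>(c, u)\<leftarrow>zip r us. c * u) rs) $ i"
    using i assms(1) by (simp add: scalar_prod_def vec_of_list_index mat_of_rows_list_def)
qed (simp add: mat_of_rows_list_def)

text \<open>Each refinement subtracts a nonnegative sawtooth. Hence the accumulating entries of the
  layers stay nonnegative, and the ReLU passes them on unchanged.\<close>

lemma square_error_le_0:
  assumes "0 \<le> t" "t \<le> 1"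
  shows "square_error k t \<le> square_error 0 t"
proof (induction k)
  case (Suc k)
  have "0 \<le> (tent ^^ Suc k) t / 4 ^ Suc k"
    using funpow_tent_bounds(1)[OF assms, of "Suc k"] by simp
  then show ?case using Suc square_error_Suc[of k t] by linarith
qed simp

text \<open>This is the invariant of the layers: in each block the first two entries are the inputs
  of \<open>relu_tent\<close>, and the third accumulates the sawtooths, written in telescoped
  form.\<close>

lemma network_block:
  assumes "0 \<le> a" "a \<le> 1" "0 \<le> b" "b \<le> 1" "k \<le> m"
    and a: "a = (x - y + 1) / 2" and b: "b = (x + y) / 2"
  shows "relu_network (P_weight m) (P_shift m) (P_input m x y) k = vec_of_list
    [(tent ^^ k) a / (2 * 4 ^ k), (tent ^^ k) a / 4 ^ k,
     b + 2 powi (- int m) / 2 + (square_error 0 a - square_error k a),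
     (tent ^^ k) b / (2 * 4 ^ k), (tent ^^ k) b / 4 ^ k,
     1/4 + (square_error 0 b - square_error k b)]"
  using assms(5)
proof (induction k)
  case 0
  show ?case
    by (rule eq_vecI) (auto simp: P_input_def a b less_Suc_eq numeral_eq_Suc field_simps)
next
  case (Suc k)
  let ?c = "b + 2 powi (- int m) / 2 + (square_error 0 a - square_error k a)"
    and ?d = "1/4 + (square_error 0 b - square_error k b)"
  have "0 \<le> ?c" "0 \<le> ?d"
    using square_error_le_0[of a k] square_error_le_0[of b k] assms(1-4)
    by (auto intro!: add_nonneg_nonneg simp del: power_int_minus)
  then have rc: "relu ?c = ?c" "relu ?d = ?d"
    by (simp_all add: relu_def)
  have ta: "relu ((tent ^^ k) a / (2 * 4 ^ k)) - relu ((tent ^^ k) a / 4 ^ k - 1 / (2 * 4 ^ k))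
      = (tent ^^ Suc k) a / 4 ^ Suc k"
    and tb: "relu ((tent ^^ k) b / (2 * 4 ^ k)) - relu ((tent ^^ k) b / 4 ^ k - 1 / (2 * 4 ^ k))
      = (tent ^^ Suc k) b / 4 ^ Suc k"
    using relu_tent funpow_tent_bounds assms by auto
  have "relu_network (P_weight m) (P_shift m) (P_input m x y) (Suc k) = vec_of_list
    [((tent ^^ Suc k) a / 4 ^ Suc k) / 2, (tent ^^ Suc k) a / 4 ^ Suc k,
     (tent ^^ Suc k) a / 4 ^ Suc k + ?c,
     ((tent ^^ Suc k) b / 4 ^ Suc k) / 2, (tent ^^ Suc k) b / 4 ^ Suc k,
     (tent ^^ Suc k) b / 4 ^ Suc k + ?d]"
    using Suc.prems unfolding relu_network.simps Suc.IH[OF Suc_leD[OF Suc.prems]]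
    \<comment> \<open>Evaluating the layer yields differences of ReLUs, so \<open>ta\<close> and
      \<open>tb\<close> are used backwards to expand the sawtooths in the goal.\<close>
    by (simp add: P_weight_block P_shift_block shifted_relu_vec_of_list
        mult_mat_of_rows_list_vec_of_list rc flip: ta tb
        del: vec_of_list_Cons funpow.simps power_Suc)
      (simp add: diff_divide_distrib)
  then show ?case
    using square_error_Suc[of k a] square_error_Suc[of k b] by (simp add: algebra_simps)
qed

text \<open>Minus the output of layer \<open>m + 1\<close>.\<close>
definition untruncated_net :: "nat \<Rightarrow> real \<Rightarrow> real \<Rightarrow> real" where
  "untruncated_net m x y = x * y + 2 powi (- int m) / 2
     + square_error (Suc m) ((x + y) / 2) - square_error (Suc m) ((x - y + 1) / 2)"

text \<open>The shifts \<open>-1\<close> of the last two layers add \<open>1\<close> before the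
  ReLU: the inner one caps the value at \<open>1\<close>, the outer one cuts it off at
  \<open>0\<close>.\<close>

lemma P_net_eq:
  assumes "(x, y) \<in> unit_square"
  shows "P_net m x y = relu (1 - relu (1 - untruncated_net m x y))"
proof -
  define a b where a: "a = (x - y + 1) / 2" and b: "b = (x + y) / 2"
  have ab: "0 \<le> a" "a \<le> 1" "0 \<le> b" "b \<le> 1"
    using assms by (auto simp: a b unit_square_def)
  let ?c = "b + 2 powi (- int m) / 2 + (square_error 0 a - square_error m a)"
    and ?d = "1/4 + (square_error 0 b - square_error m b)"
  have rc: "relu ?c = ?c" "relu ?d = ?d"
    using square_error_le_0[of a m] square_error_le_0[of b m] ab
    by (auto simp: relu_def intro!: add_nonneg_nonneg)
  have ta: "relu ((tent ^^ m) a / (2 * 4 ^ m)) - relu ((tent ^^ m) a / 4 ^ m - 1 / (2 * 4 ^ m))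
      = square_error m a - square_error (Suc m) a"
    and tb: "relu ((tent ^^ m) b / (2 * 4 ^ m)) - relu ((tent ^^ m) b / 4 ^ m - 1 / (2 * 4 ^ m))
      = square_error m b - square_error (Suc m) b"
    using relu_tent funpow_tent_bounds ab square_error_Suc[of m] by auto
  have weights: "P_weight m (Suc m) = mat_of_rows_list 6 [[-1, 1, -1, 1, -1, 1]]"
    "P_weight m (Suc (Suc m)) = mat_of_rows_list 1 [[-1]]"
    "P_weight m (Suc (Suc (Suc m))) = mat_of_rows_list 1 [[1]]"
    and shifts: "P_shift m (Suc (Suc m)) = vec_of_list [-1]"
    "P_shift m (Suc (Suc (Suc m))) = vec_of_list [-1]"
    by (simp_all add: P_weight_def P_shift_def)
  \<comment> \<open>The errors of level \<open>m\<close> cancel. Since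
    \<open>square_error 0 t = t - t^2\<close>, the rest contains
    \<open>b^2 - a^2 + a - 1/4 = x * y\<close>.\<close>
  have "untruncated_net m x y = ?c - ?d + (square_error m a - square_error (Suc m) a)
      - (square_error m b - square_error (Suc m) b)"
    unfolding untruncated_net_def a[symmetric] b[symmetric]
    by (simp add: square_error_def a b power2_eq_square field_simps)
  \<comment> \<open>The row \<open>(-1, 1, -1, 1, -1, 1)\<close> is applied to the six activations,
    bracketed as the list sum produced by simplification.\<close>
  also have "\<dots> = - (- relu ((tent ^^ m) a / (2 * 4 ^ m))
      + (relu ((tent ^^ m) a / 4 ^ m - 1 / (2 * 4 ^ m)) + (- ?c
      + (relu ((tent ^^ m) b / (2 * 4 ^ m))
      + (- relu ((tent ^^ m) b / 4 ^ m - 1 / (2 * 4 ^ m)) + ?d)))))" (is "_ = - ?Z")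
    using ta tb by linarith
  finally have Z: "untruncated_net m x y = - ?Z" .
  have "relu_network (P_weight m) (P_shift m) (P_input m x y) (Suc m) = vec_of_list [?Z]"
    unfolding relu_network.simps network_block[OF ab order_refl a b]
    by (simp add: weights P_shift_block shifted_relu_vec_of_list
        mult_mat_of_rows_list_vec_of_list rc del: vec_of_list_Cons)
  then have "relu_network (P_weight m) (P_shift m) (P_input m x y) (Suc m)
      = vec_of_list [- untruncated_net m x y]"
    using Z by simp
  then show ?thesis
    unfolding P_net_def eval_nat_numeral add_Suc_right add_0_right
      relu_network.simps(2)[of _ _ _ "Suc (Suc m)"] relu_network.simps(2)[of _ _ _ "Suc m"]
    by (simp add: weights shifts shifted_relu_vec_of_list
        mult_mat_of_rows_list_vec_of_list vec_of_list_index del: vec_of_list_Cons)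
qed

section \<open>Values and slopes before and after truncation\<close>

text \<open>Each error is at most a quarter of \<open>2 powi (- int m)\<close>, so the offset of one
  half outweighs it from below and gives \<open>3/4\<close> from above.\<close>

lemma untruncated_net_bounds:
  assumes "(x, y) \<in> unit_square"
  shows "x * y \<le> untruncated_net m x y"
    and "untruncated_net m x y \<le> x * y + 3/4 * 2 powi (- int m)"
proof -
  have ab: "0 \<le> (x - y + 1) / 2" "(x - y + 1) / 2 \<le> 1" "0 \<le> (x + y) / 2" "(x + y) / 2 \<le> 1"
    using assms by (auto simp: unit_square_def)
  have "1 / (4 ^ m * 16) \<le> (1 / (2 ^ m * 4) :: real)"
    by (intro frac_le mult_mono power_mono) auto
  then have "1 / 4 ^ Suc (Suc m) \<le> (2 powi (- int m) / 4 :: real)"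
    by (simp add: mult.commute power_int_minus inverse_eq_divide)
  then have "square_error (Suc m) ((x - y + 1) / 2) \<le> 2 powi (- int m) / 4"
    "square_error (Suc m) ((x + y) / 2) \<le> 2 powi (- int m) / 4"
    by (rule order_trans[OF square_error_bounds(2)[OF ab(1,2)]]
        order_trans[OF square_error_bounds(2)[OF ab(3,4)]])+
  then show "x * y \<le> untruncated_net m x y"
    "untruncated_net m x y \<le> x * y + 3/4 * 2 powi (- int m)"
    using square_error_bounds(1)[OF ab(1,2), of "Suc m"]
      square_error_bounds(1)[OF ab(3,4), of "Suc m"]
    unfolding untruncated_net_def by linarith+
qed

text \<open>Each of the two errors is \<open>1 / 2 ^ Suc m\<close>-Lipschitz in an argument that
  moves by \<open>(t - s) / 2\<close>; the two halves add up.\<close>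

lemma untruncated_net_slope:
  assumes "(s, y) \<in> unit_square" "(t, y) \<in> unit_square"
  shows "\<bar>untruncated_net m t y - untruncated_net m s y - (t - s) * y\<bar> \<le> 2 powi (- int m - 1) * \<bar>t - s\<bar>"
proof -
  let ?A = "square_error (Suc m) ((t + y) / 2) - square_error (Suc m) ((s + y) / 2)"
    and ?B = "square_error (Suc m) ((t - y + 1) / 2) - square_error (Suc m) ((s - y + 1) / 2)"
  have diff: "(t + y) / 2 - (s + y) / 2 = (t - s) / 2"
    "(t - y + 1) / 2 - (s - y + 1) / 2 = (t - s) / 2"
    by (simp_all add: field_simps)
  have "\<bar>?A\<bar> \<le> \<bar>(t + y) / 2 - (s + y) / 2\<bar> / 2 ^ Suc m"
    "\<bar>?B\<bar> \<le> \<bar>(t - y + 1) / 2 - (s - y + 1) / 2\<bar> / 2 ^ Suc m"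
    using assms by (intro square_error_lipschitz; auto simp: unit_square_def)+
  then have AB: "\<bar>?A\<bar> \<le> \<bar>(t - s) / 2\<bar> / 2 ^ Suc m" "\<bar>?B\<bar> \<le> \<bar>(t - s) / 2\<bar> / 2 ^ Suc m"
    unfolding diff .
  have "untruncated_net m t y - untruncated_net m s y - (t - s) * y = ?A - ?B"
    by (simp add: untruncated_net_def algebra_simps)
  also have "\<bar>?A - ?B\<bar> \<le> \<bar>?A\<bar> + \<bar>?B\<bar>"
    by (rule abs_triangle_ineq4)
  also have "\<dots> \<le> \<bar>(t - s) / 2\<bar> / 2 ^ Suc m + \<bar>(t - s) / 2\<bar> / 2 ^ Suc m"
    by (rule add_mono[OF AB])
  also have "\<dots> = 2 powi (- int m - 1) * \<bar>t - s\<bar>"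
    by (simp add: power_int_diff power_int_minus inverse_eq_divide)
  finally show ?thesis .
qed

text \<open>The constant \<open>3/4\<close> leaves a strip to the right of
  \<open>C_region m\<close>, so that slopes can be measured near its edge too.\<close>

lemma P_net_eq_untruncated_net:
  assumes "(x, y) \<in> unit_square" "x \<le> 1 - 3/4 * 2 powi (- int m)"
  shows "P_net m x y = untruncated_net m x y"
proof -
  have "0 \<le> x * y" "x * y \<le> x"
    using assms(1) by (auto simp: unit_square_def mult_left_le)
  then show ?thesis
    using untruncated_net_bounds[OF assms(1), of m] assms(2)
    by (simp add: P_net_eq[OF assms(1)] relu_def)
qed

text \<open>The point may lie on the boundary of its piece. It is approximated by an interior point
  \<open>(s, z)\<close>, where a short horizontal segment inside \<open>S\<close> reveals the slope;
  replacing \<open>z\<close> by \<open>y\<close> costs less than \<open>e\<close>.\<close>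

lemma P_net_slope_bound:
  assumes S: "convex S" "interior S \<noteq> {}" "S \<subseteq> unit_square"
    and slope: "has_x_slope_on (P_net m) a S"
    and p: "(x, y) \<in> S" "x \<le> 1 - 2 powi (- int m)"
  shows "\<bar>a - y\<bar> \<le> 2 powi (- int m - 1)"
proof (rule field_le_epsilon)
  fix e :: real assume "e > 0"
  \<comment> \<open>With this \<open>d\<close>, both \<open>s\<close> and \<open>t\<close> stay
    below \<open>x + 2 * d\<close>, hence within the strip of width
    \<open>2 powi (- int m) / 4\<close>.\<close>
  define d where "d = min e (2 powi (- int m) / 8)"
  have d: "d > 0" "d \<le> e" "d \<le> 2 powi (- int m) / 8"
    using \<open>e > 0\<close> by (auto simp: d_def)
  have "(x, y) \<in> closure (interior S)"
    using convex_closure_interior[OF S(1,2)] p(1) closure_subset by blast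
  then obtain q where q: "q \<in> interior S" "dist q (x, y) < d"
    using d(1) by (auto simp: closure_approachable)
  obtain s z where sz: "q = (s, z)" by fastforce
  obtain r where r: "r > 0" "ball (s, z) r \<subseteq> S"
    using q(1) sz mem_interior by blast
  define t where "t = s + min r d / 2"
  have t: "s < t" "t - s < r" "t - s < d"
    using r d by (auto simp: t_def)
  have "(t, z) \<in> S" "(s, z) \<in> S"
    using r t by (auto simp: subset_iff dist_Pair_Pair dist_real_def)
  then have in_square: "(t, z) \<in> unit_square" "(s, z) \<in> unit_square"
    using S(3) by auto
  have near: "\<bar>s - x\<bar> < d" "\<bar>z - y\<bar> < d"
    using q(2) dist_fst_le[of q "(x, y)"] dist_snd_le[of q "(x, y)"]
    by (auto simp: sz dist_real_def)
  obtain b c where "\<forall>(x, y)\<in>S. P_net m x y = a * x + b * y + c"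
    using slope by (auto simp: has_x_slope_on_def)
  with \<open>(t, z) \<in> S\<close> \<open>(s, z) \<in> S\<close>
  have "P_net m t z = a * t + b * z + c" "P_net m s z = a * s + b * z + c"
    by auto
  then have "P_net m t z - P_net m s z = a * (t - s)"
    by (simp add: algebra_simps)
  moreover have "t \<le> 1 - 3/4 * 2 powi (- int m)" "s \<le> 1 - 3/4 * 2 powi (- int m)"
    using near t d p(2) by linarith+
  ultimately have "untruncated_net m t z - untruncated_net m s z - (t - s) * z = (a - z) * (t - s)"
    using P_net_eq_untruncated_net in_square by (simp add: algebra_simps)
  then have "\<bar>a - z\<bar> * \<bar>t - s\<bar> \<le> 2 powi (- int m - 1) * \<bar>t - s\<bar>"
    using untruncated_net_slope[OF in_square(2,1), of m] by (simp only: abs_mult)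
  then have "\<bar>a - z\<bar> \<le> 2 powi (- int m - 1)"
    using t(1) by simp
  then show "\<bar>a - y\<bar> \<le> 2 powi (- int m - 1) + e"
    using near(2) d(2) by linarith
qed

section \<open>Piecewise linearity of ReLU networks\<close>

text \<open>Unlike \<^const>\<open>piecewise_linear_on\<close>, this allows degenerate pieces, which makes it stable
  under common refinements.\<close>
definition piecewise_affine_on :: "(real \<times> real) set \<Rightarrow> (real \<Rightarrow> real \<Rightarrow> real) \<Rightarrow> bool" where
  "piecewise_affine_on Q f \<longleftrightarrow> (\<exists>\<S>. finite \<S> \<and> \<Union>\<S> = Q \<and>
     (\<forall>S\<in>\<S>. polytope S \<and> (\<exists>a. has_x_slope_on f a S)))"

lemma piecewise_affine_onI:
  assumes "finite \<S>" "\<Union>\<S> = Q" "\<And>S. S \<in> \<S> \<Longrightarrow> polytope S"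
    "\<And>S. S \<in> \<S> \<Longrightarrow> \<exists>a. has_x_slope_on f a S"
  shows "piecewise_affine_on Q f"
  using assms unfolding piecewise_affine_on_def by blast

lemma piecewise_affine_on_affine:
  "polytope Q \<Longrightarrow> piecewise_affine_on Q (\<lambda>x y. a * x + b * y + c)"
  by (rule piecewise_affine_onI[of "{Q}"]) (auto simp: has_x_slope_on_def)

lemma piecewise_affine_on_const: "polytope Q \<Longrightarrow> piecewise_affine_on Q (\<lambda>x y. c)"
  using piecewise_affine_on_affine[of Q 0 0 c] by simp

text \<open>Pairwise intersections of the pieces form a common refinement, possibly with degenerate
  pieces.\<close>

lemma piecewise_affine_on_add:
  assumes "piecewise_affine_on Q f" "piecewise_affine_on Q g"
  shows "piecewise_affine_on Q (\<lambda>x y. f x y + g x y)"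
proof -
  obtain \<S> where \<S>: "finite \<S>" "\<Union>\<S> = Q" "\<And>S. S \<in> \<S> \<Longrightarrow> polytope S"
    "\<And>S. S \<in> \<S> \<Longrightarrow> \<exists>a. has_x_slope_on f a S"
    using assms(1) unfolding piecewise_affine_on_def by blast
  obtain \<T> where \<T>: "finite \<T>" "\<Union>\<T> = Q" "\<And>T. T \<in> \<T> \<Longrightarrow> polytope T"
    "\<And>T. T \<in> \<T> \<Longrightarrow> \<exists>a. has_x_slope_on g a T"
    using assms(2) unfolding piecewise_affine_on_def by blast
  show ?thesis
  proof (rule piecewise_affine_onI[of "(\<lambda>(S, T). S \<inter> T) ` (\<S> \<times> \<T>)"])
    show "\<Union> ((\<lambda>(S, T). S \<inter> T) ` (\<S> \<times> \<T>)) = Q"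
      using \<S>(2) \<T>(2) by blast
    fix U assume "U \<in> (\<lambda>(S, T). S \<inter> T) ` (\<S> \<times> \<T>)"
    then obtain S T where ST: "S \<in> \<S>" "T \<in> \<T>" "U = S \<inter> T" by blast
    then show "polytope U" using \<S>(3) \<T>(3) by (simp add: polytope_Int)
    obtain a b c where f: "\<forall>(x, y)\<in>S. f x y = a * x + b * y + c"
      using \<S>(4)[OF ST(1)] unfolding has_x_slope_on_def by blast
    obtain a' b' c' where g: "\<forall>(x, y)\<in>T. g x y = a' * x + b' * y + c'"
      using \<T>(4)[OF ST(2)] unfolding has_x_slope_on_def by blast
    have "\<forall>(x, y)\<in>U. f x y + g x y = (a + a') * x + (b + b') * y + (c + c')"
      using f g ST(3) by (fastforce simp: algebra_simps)
    then show "\<exists>a. has_x_slope_on (\<lambda>x y. f x y + g x y) a U"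
      unfolding has_x_slope_on_def by blast
  qed (use \<S>(1) \<T>(1) in simp)
qed

lemma piecewise_affine_on_cmult:
  assumes "piecewise_affine_on Q f"
  shows "piecewise_affine_on Q (\<lambda>x y. k * f x y)"
proof -
  obtain \<S> where \<S>: "finite \<S>" "\<Union>\<S> = Q" "\<And>S. S \<in> \<S> \<Longrightarrow> polytope S"
    "\<And>S. S \<in> \<S> \<Longrightarrow> \<exists>a. has_x_slope_on f a S"
    using assms(1) unfolding piecewise_affine_on_def by blast
  show ?thesis
  proof (rule piecewise_affine_onI[OF \<S>(1,2,3)])
    fix S assume "S \<in> \<S>"
    then obtain a b c where f: "\<forall>(x, y)\<in>S. f x y = a * x + b * y + c"
      using \<S>(4) unfolding has_x_slope_on_def by blast
    then have "\<forall>(x, y)\<in>S. k * f x y = (k * a) * x + (k * b) * y + k * c"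
      by (fastforce simp: algebra_simps)
    then show "\<exists>a. has_x_slope_on (\<lambda>x y. k * f x y) a S"
      unfolding has_x_slope_on_def by blast
  qed
qed

lemma piecewise_affine_on_sum:
  assumes "polytope Q" "\<And>i. i \<in> I \<Longrightarrow> piecewise_affine_on Q (f i)"
  shows "piecewise_affine_on Q (\<lambda>x y. \<Sum>i\<in>I. f i x y)"
  using assms(2)
  by (induction I rule: infinite_finite_induct)
    (auto intro: piecewise_affine_on_add piecewise_affine_on_const[OF assms(1)])

text \<open>Each piece is cut along the line where its affine function changes sign; both parts are
  intersections with halfspaces.\<close>

lemma piecewise_affine_on_relu:
  assumes "piecewise_affine_on Q f"
  shows "piecewise_affine_on Q (\<lambda>x y. relu (f x y))"
proof -
  obtain \<S> where \<S>: "finite \<S>" "\<Union>\<S> = Q" "\<And>S. S \<in> \<S> \<Longrightarrow> polytope S"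
    "\<And>S. S \<in> \<S> \<Longrightarrow> \<exists>a. has_x_slope_on f a S"
    using assms(1) unfolding piecewise_affine_on_def by blast
  let ?pos = "{(x, y). 0 \<le> f x y}" and ?neg = "{(x, y). f x y \<le> 0}"
  have pieces: "polytope (S \<inter> ?pos) \<and> polytope (S \<inter> ?neg) \<and>
      (\<exists>a. has_x_slope_on (\<lambda>x y. relu (f x y)) a (S \<inter> ?pos)) \<and>
      (\<exists>a. has_x_slope_on (\<lambda>x y. relu (f x y)) a (S \<inter> ?neg))" if S: "S \<in> \<S>" for S
  proof -
    obtain a b c where "\<forall>(x, y)\<in>S. f x y = a * x + b * y + c"
      using \<S>(4)[OF S] unfolding has_x_slope_on_def by blast
    then have f: "f x y = a * x + b * y + c" if "(x, y) \<in> S" for x y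
      using that by auto
    have "S \<inter> ?pos = S \<inter> {z. (a, b) \<bullet> z \<ge> - c}" "S \<inter> ?neg = S \<inter> {z. (a, b) \<bullet> z \<le> - c}"
      by (auto simp: f)
    then have "polytope (S \<inter> ?pos)" "polytope (S \<inter> ?neg)"
      using polytope_Int_polyhedron[OF \<S>(3)[OF S] polyhedron_halfspace_ge, of "- c" "(a, b)"]
        polytope_Int_polyhedron[OF \<S>(3)[OF S] polyhedron_halfspace_le, of "(a, b)" "- c"]
      by (simp_all only:)
    moreover have "\<forall>(x, y)\<in>S \<inter> ?pos. relu (f x y) = a * x + b * y + c"
      by (auto simp: relu_def f)
    moreover have "\<forall>(x, y)\<in>S \<inter> ?neg. relu (f x y) = 0 * x + 0 * y + 0"
      by (auto simp: relu_def)
    ultimately show ?thesis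
      unfolding has_x_slope_on_def by blast
  qed
  let ?\<T> = "(\<lambda>S. S \<inter> ?pos) ` \<S> \<union> (\<lambda>S. S \<inter> ?neg) ` \<S>"
  show ?thesis
  proof (rule piecewise_affine_onI)
    show "finite ?\<T>" using \<S>(1) by simp
    have "?pos \<union> ?neg = UNIV" by auto
    then show "\<Union>?\<T> = Q" using \<S>(2) by blast
  qed (use pieces in blast)+
qed

lemma piecewise_affine_on_network:
  assumes "polytope Q" "\<And>x y. dim_vec (l x y) = n"
    "\<And>i. i < n \<Longrightarrow> piecewise_affine_on Q (\<lambda>x y. l x y $ i)"
    "i < (case k of 0 \<Rightarrow> n | Suc _ \<Rightarrow> dim_row (w k))"
  shows "piecewise_affine_on Q (\<lambda>x y. relu_network w v (l x y) k $ i)"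
  using assms(4)
proof (induction k arbitrary: i)
  case 0
  then show ?case using assms(3) by simp
next
  case (Suc k)
  \<comment> \<open>This is the width of the layer below, over which the matrix product
    sums.\<close>
  define d where "d = (case k of 0 \<Rightarrow> n | Suc _ \<Rightarrow> dim_row (w k))"
  have "dim_vec (relu_network w v (l x y) k) = d" for x y
    by (cases k) (auto simp: d_def assms(2))
  then have "relu_network w v (l x y) (Suc k) $ i = (\<Sum>j = 0..<d. row (w (Suc k)) i $ j *
      relu (relu_network w v (l x y) k $ j + - v (Suc k) $ j))" for x y
    using Suc.prems by (simp add: scalar_prod_def shifted_relu_def)
  moreover have "piecewise_affine_on Q (\<lambda>x y. \<Sum>j = 0..<d. row (w (Suc k)) i $ j *
      relu (relu_network w v (l x y) k $ j + - v (Suc k) $ j))"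
    using Suc.IH
    by (intro piecewise_affine_on_sum piecewise_affine_on_cmult piecewise_affine_on_relu
        piecewise_affine_on_add piecewise_affine_on_const assms(1)) (auto simp: d_def)
  ultimately show ?case by simp
qed

lemma interior_Union_closed_empty_interior:
  assumes "finite \<T>" "\<And>T. T \<in> \<T> \<Longrightarrow> closed T \<and> interior T = {}"
  shows "interior (\<Union>\<T>) = {}"
  using assms
  by (induction \<T> rule: finite_induct)
    (auto simp: interior_closed_Un_empty_interior)

lemma piecewise_affine_on_imp_piecewise_linear_on:
  assumes "piecewise_affine_on Q f" "Q \<subseteq> closure (interior Q)"
  shows "piecewise_linear_on Q f"
proof -
  obtain \<S> where \<S>: "finite \<S>" "\<Union>\<S> = Q" "\<And>S. S \<in> \<S> \<Longrightarrow> polytope S"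
    "\<And>S. S \<in> \<S> \<Longrightarrow> \<exists>a. has_x_slope_on f a S"
    using assms(1) unfolding piecewise_affine_on_def by blast
  define \<T> where "\<T> = {S \<in> \<S>. interior S \<noteq> {}}"
  let ?N = "\<Union>{S \<in> \<S>. interior S = {}}"
  have closed: "closed (\<Union>\<T>)"
    unfolding \<T>_def using \<S>(1,3) by (intro closed_Union) (auto intro: polytope_imp_closed)
  have N: "interior ?N = {}"
    using \<S>(1,3) by (intro interior_Union_closed_empty_interior) (auto intro: polytope_imp_closed)
  have "interior Q - \<Union>\<T> \<subseteq> ?N"
    using \<S>(2) interior_subset[of Q] unfolding \<T>_def by blast
  then have "interior Q - \<Union>\<T> \<subseteq> interior ?N"
    by (intro interior_maximal open_Diff open_interior closed)
  then have "interior Q \<subseteq> \<Union>\<T>" using N by blast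
  then have "Q \<subseteq> \<Union>\<T>"
    using assms(2) closure_minimal[OF _ closed] by blast
  then have "\<Union>\<T> = Q" using \<S>(2) by (auto simp: \<T>_def)
  then show ?thesis
    using \<S> unfolding piecewise_linear_on_def linear_pieces_def
    by (intro exI[of _ \<T>]) (auto simp: \<T>_def)
qed

lemma unit_square_cbox: "unit_square = cbox (0, 0) (1, 1)"
  by (simp add: unit_square_def cbox_Pair_eq)

lemma P_net_piecewise_linear: "piecewise_linear_on unit_square (P_net m)"
proof (rule piecewise_affine_on_imp_piecewise_linear_on)
  have poly: "polytope unit_square"
    by (simp add: unit_square_cbox polytope_interval)
  have input: "piecewise_affine_on unit_square (\<lambda>x y. P_input m x y $ i)" if "i < 6" for i
  proof -
    have "i = 0 \<or> i = 1 \<or> i = 2 \<or> i = 3 \<or> i = 4 \<or> i = 5"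
      using that by auto
    \<comment> \<open>Selecting the coefficients by \<open>!\<close> lets one instance of
      \<open>piecewise_affine_on_affine\<close> serve all six entries.\<close>
    then have "P_input m x y $ i =
        [1/4, 1/2, 1/2, 1/4, 1/2, 0] ! i * x + [-1/4, -1/2, 1/2, 1/4, 1/2, 0] ! i * y
        + [1/4, 1/2, 2 powi (- int m) / 2, 0, 0, 1/4] ! i" for x y
      by (elim disjE) (simp_all add: P_input_def vec_of_list_index add_divide_distrib
          diff_divide_distrib del: vec_of_list_Cons power_int_minus)
    then show ?thesis by (simp only: piecewise_affine_on_affine[OF poly])
  qed
  have "0 < (case m + 3 of 0 \<Rightarrow> 6 | Suc k \<Rightarrow> dim_row (P_weight m (m + 3)))"
    by (simp add: P_weight_def mat_of_rows_list_def split: nat.split)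
  then show "piecewise_affine_on unit_square (P_net m)"
    unfolding P_net_def
    by (intro piecewise_affine_on_network[where n = 6, OF poly _ input]) (simp_all add: P_input_def)
  have "interior unit_square \<noteq> {}"
    by (simp add: unit_square_def interior_Times)
  moreover have "convex unit_square"
    by (simp add: unit_square_cbox)
  ultimately show "unit_square \<subseteq> closure (interior unit_square)"
    using convex_closure_interior closure_subset by metis
qed

text \<open>Quantifying over \<open>D\<close> covers every choice of pieces and every assignment of
  breakpoints. Boundedness is asserted alongside the supremum because \<open>SUP\<close> on the
  reals is meaningful only for bounded sets.\<close>

theorem lemma2p1:
  fixes m :: nat
  shows "piecewise_linear_on unit_square (P_net m)
     \<and> (\<forall>(x, y)\<in>unit_square. 0 \<le> P_net m x y \<and> P_net m x y \<le> 1) \<and> P_net m 1 1 = 1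
     \<and> (\<forall>(x, y)\<in>C_region m. 0 \<le> P_net m x y - x * y \<and> P_net m x y - x * y \<le> 2 powi (- int m))
     \<and> (\<forall>D. piecewise_x_derivative unit_square (P_net m) D \<longrightarrow>
           bdd_above ((\<lambda>(x, y). \<bar>D x y - y\<bar>) ` C_region m) \<and>
           (SUP (x, y)\<in>C_region m. \<bar>D x y - y\<bar>) \<le> 2 powi (- int m - 1))"
proof (intro conjI allI impI)
  have pos: "0 < (2::real) powi (- int m)" by simp
  have C: "(x, y) \<in> unit_square" if "(x, y) \<in> C_region m" for x y
  proof -
    have "0 \<le> x" "x \<le> 1 - 2 powi (- int m)" "y \<in> {0..1}"
      using that by (simp_all add: C_region_def)
    moreover from this pos have "x \<le> 1" by linarith
    ultimately show ?thesis by (simp add: unit_square_def)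
  qed
  show "piecewise_linear_on unit_square (P_net m)"
    by (rule P_net_piecewise_linear)
  show "\<forall>(x, y)\<in>unit_square. 0 \<le> P_net m x y \<and> P_net m x y \<le> 1"
    using P_net_eq by (auto simp: relu_def)
  have "(1, 1) \<in> unit_square" by (simp add: unit_square_def)
  \<comment> \<open>The lower bound gives at least \<open>1\<close> before truncation, which then
    returns exactly \<open>1\<close>.\<close>
  then show "P_net m 1 1 = 1"
    using untruncated_net_bounds(1)[of 1 1 m] by (simp add: P_net_eq relu_def)
  show "\<forall>(x, y)\<in>C_region m. 0 \<le> P_net m x y - x * y \<and> P_net m x y - x * y \<le> 2 powi (- int m)"
  proof safe
    fix x y assume xy: "(x, y) \<in> C_region m"
    have "x \<le> 1 - 2 powi (- int m)" using xy by (simp add: C_region_def)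
    with pos have "P_net m x y = untruncated_net m x y"
      by (intro P_net_eq_untruncated_net C xy) linarith
    then show "0 \<le> P_net m x y - x * y" "P_net m x y - x * y \<le> 2 powi (- int m)"
      using untruncated_net_bounds[OF C[OF xy], of m] pos by linarith+
  qed
  fix D assume "piecewise_x_derivative unit_square (P_net m) D"
  then obtain \<S> piece where \<S>: "linear_pieces (P_net m) unit_square \<S>"
    and piece: "\<forall>(x, y)\<in>unit_square. piece (x, y) \<in> \<S> \<and> (x, y) \<in> piece (x, y) \<and>
        has_x_slope_on (P_net m) (D x y) (piece (x, y))"
    unfolding piecewise_x_derivative_def by blast
  have bound: "\<bar>D x y - y\<bar> \<le> 2 powi (- int m - 1)" if "(x, y) \<in> C_region m" for x y
  proof (rule P_net_slope_bound[of "piece (x, y)"])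
    show "convex (piece (x, y))" "interior (piece (x, y)) \<noteq> {}" "piece (x, y) \<subseteq> unit_square"
      "has_x_slope_on (P_net m) (D x y) (piece (x, y))" "(x, y) \<in> piece (x, y)"
      using \<S> piece C[OF that] polytope_imp_convex unfolding linear_pieces_def by blast+
    show "x \<le> 1 - 2 powi (- int m)" using that by (simp add: C_region_def)
  qed
  then show "bdd_above ((\<lambda>(x, y). \<bar>D x y - y\<bar>) ` C_region m)"
    by (intro bdd_aboveI[of _ "2 powi (- int m - 1)"]) auto
  \<comment> \<open>The supremum needs a nonempty region; for \<open>m = 0\<close> it is the edge
    \<open>{0} \<times> {0..1}\<close>.\<close>
  have "(0, 0) \<in> C_region m"
    by (simp add: C_region_def power_int_minus inverse_le_1_iff)
  then show "(SUP (x, y)\<in>C_region m. \<bar>D x y - y\<bar>) \<le> 2 powi (- int m - 1)"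
    using bound by (intro cSUP_least) auto
qed

end
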